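(* Let $v$ be a generic twisted $J$-corrugated $(N,M)$-hedron in $\mathbb{RP}^3$ with $J=\{(0,0),(0,1),(1,0),(1,1)\}$, let $\tilde v$ be its image under the pentagram-type map $$\tilde v_{i,j}=(v_{i,j},v_{i,j+1})\cap(v_{i+1,j},v_{i+1,j+1}),$$ and set $$y_{i,j}=-[v_{i+1,j},\tilde v_{i,j},v_{i+1,j+1},\tilde v_{i+1,j}].$$ Denote by $\tilde y_{i,j}$ and $\tilde{\tilde y}_{i,j}$ the corresponding variables after one, respectively two, iterations of the map. Then for all $(i,j)\in\mathbb Z^2$ $$y_{i+2,j+1}\,\tilde{\tilde y}_{i+1,j}=\frac{(1+\tilde y_{i+1,j})(1+\tilde y_{i+2,j+1})}{\bigl(1+\tilde y_{i+2,j}^{-1}\bigr)\bigl(1+\tilde y_{i+1,j+1}^{-1}\bigr)}.$$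
   Context: $(u,w)$ denotes the line through $u$ and $w$. A polyhedron in $\mathbb{RP}^3$ is a map $v:\mathbb Z^2\to\mathbb{RP}^3$. It is $J$-corrugated (for the given $J$) if for all $(i,j)$ the points $v_{i,j},v_{i,j+1},v_{i+1,j},v_{i+1,j+1}$ are coplanar. It is a twisted $(N,M)$-hedron if there are fixed commuting projective transformations $\phi_1,\phi_2$ with $v_{i+N,j}=\phi_1(v_{i,j})$ and $v_{i,j+M}=\phi_2(v_{i,j})$ for all $(i,j)$. "Generic" includes: no three of the four vertices of any elementary quadrilateral are collinear, and the iterates of the map and the variables involved are well defined. Cross-ratio: for four collinear points represented by vectors $X,Y,Z,W$ (in a common 2-dimensional subspace) with $Y=\lambda_1X+\lambda_2Z$ and $W=\mu_1X+\mu_2Z$, set $[X,Y,Z,W]=\dfrac{\lambda_2\mu_1}{\lambda_1\mu_2}$. (The points $v_{i+1,j},\tilde v_{i,j},v_{i+1,j+1},\tilde v_{i+1,j}$ lie on the line $(v_{i+1,j},v_{i+1,j+1})$.) *)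

theory Defs
  imports "HOL-Analysis.Analysis"
begin

text \<open>Points, lines and planes of \<open>RP\<^sup>3\<close> are the linear subspaces of dimension 1, 2 and 3
  of \<open>\<real>\<^sup>4\<close>, so that incidence is inclusion and intersection is set intersection.\<close>

definition represents :: "real ^ 4 \<Rightarrow> (real ^ 4) set \<Rightarrow> bool" where
  "represents X P \<longleftrightarrow> X \<noteq> 0 \<and> P = span {X}"

definition RP3 :: "(real ^ 4) set set" where
  "RP3 = {P. \<exists>X. represents X P}"

definition proj_collinear :: "(real ^ 4) set set \<Rightarrow> bool" where
  "proj_collinear S \<longleftrightarrow> (\<exists>L. subspace L \<and> dim L = 2 \<and> (\<forall>P\<in>S. P \<subseteq> L))"

definition proj_coplanar :: "(real ^ 4) set set \<Rightarrow> bool" where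
  "proj_coplanar S \<longleftrightarrow> (\<exists>H. subspace H \<and> dim H = 3 \<and> (\<forall>P\<in>S. P \<subseteq> H))"

text \<open>This is a line only if the two points are distinct.\<close>

definition line_through :: "(real ^ 4) set \<Rightarrow> (real ^ 4) set \<Rightarrow> (real ^ 4) set" where
  "line_through u w = span (u \<union> w)"

definition projective_transformation :: "((real ^ 4) set \<Rightarrow> (real ^ 4) set) \<Rightarrow> bool" where
  "projective_transformation \<phi> \<longleftrightarrow>
     (\<exists>A :: real ^ 4 \<Rightarrow> real ^ 4. linear A \<and> bij A \<and> (\<forall>P\<in>RP3. \<phi> P = A ` P))"

text \<open>The condition \<open>P \<noteq> R\<close> says that \<open>X\<close> and \<open>Z\<close> span a 2-dimensional subspace. The four points
  have a cross-ratio iff in addition they are collinear and the denominator does not vanish.\<close>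

definition has_cross_ratio ::
  "(real ^ 4) set \<Rightarrow> (real ^ 4) set \<Rightarrow> (real ^ 4) set \<Rightarrow> (real ^ 4) set \<Rightarrow> real \<Rightarrow> bool" where
  "has_cross_ratio P Q R S c \<longleftrightarrow> P \<noteq> R \<and>
     (\<exists>X Y Z W l1 l2 m1 m2.
        represents X P \<and> represents Y Q \<and> represents Z R \<and> represents W S \<and>
        Y = l1 *\<^sub>R X + l2 *\<^sub>R Z \<and> W = m1 *\<^sub>R X + m2 *\<^sub>R Z \<and>
        l1 * m2 \<noteq> 0 \<and> c = (l2 * m1) / (l1 * m2))"

definition cross_ratio ::
  "(real ^ 4) set \<Rightarrow> (real ^ 4) set \<Rightarrow> (real ^ 4) set \<Rightarrow> (real ^ 4) set \<Rightarrow> real" where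
  "cross_ratio P Q R S = (THE c. has_cross_ratio P Q R S c)"

lemma represents_scale:
  assumes "represents X P" "represents X' P"
  obtains s where "s \<noteq> 0" "X' = s *\<^sub>R X"
proof -
  have "X' \<in> span {X}"
    using assms unfolding represents_def by (metis insertI1 span_base)
  then obtain s where "X' = s *\<^sub>R X"
    by (auto simp: span_singleton)
  with assms that show thesis
    by (auto simp: represents_def)
qed

lemma represents_indep:
  assumes "represents X P" "represents Z R" "P \<noteq> R" "a *\<^sub>R X + b *\<^sub>R Z = 0"
  shows "a = 0 \<and> b = 0"
proof (rule ccontr)
  assume neg: "\<not> (a = 0 \<and> b = 0)"
  have nz: "X \<noteq> 0" "Z \<noteq> 0" using assms by (auto simp: represents_def)
  have ab: "a \<noteq> 0" "b \<noteq> 0"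
    using neg assms(4) nz by auto
  have eq: "a *\<^sub>R X = - (b *\<^sub>R Z)"
    using assms(4) by (simp add: eq_neg_iff_add_eq_0)
  have "(inverse a * a) *\<^sub>R X = (- (b / a)) *\<^sub>R Z"
    using arg_cong[OF eq, of "\<lambda>u. inverse a *\<^sub>R u"] by (simp add: divide_inverse mult.commute)
  then have "X = (- (b / a)) *\<^sub>R Z"
    using ab by simp
  then obtain k where k: "X = k *\<^sub>R Z" by blast
  then have "k \<noteq> 0" using nz by auto
  have "span {X} \<subseteq> span {Z}"
    unfolding k span_singleton by auto
  moreover have "span {Z} \<subseteq> span {X}"
  proof
    fix u assume "u \<in> span {Z}"
    then obtain t where "u = t *\<^sub>R Z" by (auto simp: span_singleton)
    then have "u = (t / k) *\<^sub>R X" using k \<open>k \<noteq> 0\<close> by simp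
    then show "u \<in> span {X}" by (auto simp: span_singleton)
  qed
  ultimately have "span {X} = span {Z}" by blast
  then show False
    using assms by (simp add: represents_def)
qed

lemma has_cross_ratio_unique:
  assumes "has_cross_ratio P Q R S c" "has_cross_ratio P Q R S c'"
  shows "c = c'"
proof -
  have PR: "P \<noteq> R" using assms(1) by (simp add: has_cross_ratio_def)
  obtain X Y Z W l1 l2 m1 m2 where
    1: "represents X P" "represents Y Q" "represents Z R" "represents W S"
      "Y = l1 *\<^sub>R X + l2 *\<^sub>R Z" "W = m1 *\<^sub>R X + m2 *\<^sub>R Z"
      "l1 * m2 \<noteq> 0" "c = (l2 * m1) / (l1 * m2)"
    using assms(1) unfolding has_cross_ratio_def by blast
  obtain X' Y' Z' W' l1' l2' m1' m2' where
    2: "represents X' P" "represents Y' Q" "represents Z' R" "represents W' S"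
      "Y' = l1' *\<^sub>R X' + l2' *\<^sub>R Z'" "W' = m1' *\<^sub>R X' + m2' *\<^sub>R Z'"
      "l1' * m2' \<noteq> 0" "c' = (l2' * m1') / (l1' * m2')"
    using assms(2) unfolding has_cross_ratio_def by blast
  obtain p where p: "p \<noteq> 0" "X' = p *\<^sub>R X" using represents_scale 1(1) 2(1) by metis
  obtain q where q: "q \<noteq> 0" "Y' = q *\<^sub>R Y" using represents_scale 1(2) 2(2) by metis
  obtain r where r: "r \<noteq> 0" "Z' = r *\<^sub>R Z" using represents_scale 1(3) 2(3) by metis
  obtain s where s: "s \<noteq> 0" "W' = s *\<^sub>R W" using represents_scale 1(4) 2(4) by metis
  have "(q * l1 - l1' * p) *\<^sub>R X + (q * l2 - l2' * r) *\<^sub>R Z = 0"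
    using 1(5) 2(5) p q r by (simp add: algebra_simps)
  then have e1: "q * l1 = l1' * p" "q * l2 = l2' * r"
    using represents_indep[OF 1(1) 1(3) PR] by fastforce+
  have "(s * m1 - m1' * p) *\<^sub>R X + (s * m2 - m2' * r) *\<^sub>R Z = 0"
    using 1(6) 2(6) p r s by (simp add: algebra_simps)
  then have e2: "s * m1 = m1' * p" "s * m2 = m2' * r"
    using represents_indep[OF 1(1) 1(3) PR] by fastforce+
  have "c = ((q * l2) * (s * m1)) / ((q * l1) * (s * m2))"
    using 1(8) q s by (simp add: field_simps)
  also have "\<dots> = c'"
    unfolding e1 e2 2(8) using p r by (simp add: field_simps)
  finally show ?thesis .
qed

lemma cross_ratio_eq: "has_cross_ratio P Q R S c \<Longrightarrow> cross_ratio P Q R S = c"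
  unfolding cross_ratio_def using has_cross_ratio_unique by blast

definition twisted_hedron :: "nat \<Rightarrow> nat \<Rightarrow> (int \<Rightarrow> int \<Rightarrow> (real ^ 4) set) \<Rightarrow> bool" where
  "twisted_hedron N M v \<longleftrightarrow> N \<ge> 1 \<and> M \<ge> 1 \<and> (\<forall>i j. v i j \<in> RP3) \<and>
     (\<exists>\<phi>1 \<phi>2. projective_transformation \<phi>1 \<and> projective_transformation \<phi>2 \<and>
        (\<forall>P\<in>RP3. \<phi>1 (\<phi>2 P) = \<phi>2 (\<phi>1 P)) \<and>
        (\<forall>i j. v (i + int N) j = \<phi>1 (v i j) \<and> v i (j + int M) = \<phi>2 (v i j)))"

definition corrugated :: "(int \<times> int) set \<Rightarrow> (int \<Rightarrow> int \<Rightarrow> (real ^ 4) set) \<Rightarrow> bool" where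
  "corrugated J v \<longleftrightarrow> (\<forall>i j. proj_coplanar ((\<lambda>(a, b). v (i + a) (j + b)) ` J))"

definition pentagram ::
  "(int \<Rightarrow> int \<Rightarrow> (real ^ 4) set) \<Rightarrow> int \<Rightarrow> int \<Rightarrow> (real ^ 4) set" where
  "pentagram v i j =
     line_through (v i j) (v i (j + 1)) \<inter> line_through (v (i + 1) j) (v (i + 1) (j + 1))"

definition y_var :: "(int \<Rightarrow> int \<Rightarrow> (real ^ 4) set) \<Rightarrow> int \<Rightarrow> int \<Rightarrow> real" where
  "y_var v i j =
     - cross_ratio (v (i + 1) j) (pentagram v i j) (v (i + 1) (j + 1)) (pentagram v (i + 1) j)"

definition pentagram_defined :: "(int \<Rightarrow> int \<Rightarrow> (real ^ 4) set) \<Rightarrow> bool" where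
  "pentagram_defined v \<longleftrightarrow> (\<forall>i j. v i j \<noteq> v i (j + 1) \<and> pentagram v i j \<in> RP3)"

definition y_defined :: "(int \<Rightarrow> int \<Rightarrow> (real ^ 4) set) \<Rightarrow> bool" where
  "y_defined v \<longleftrightarrow> (\<forall>i j. \<exists>c. has_cross_ratio
     (v (i + 1) j) (pentagram v i j) (v (i + 1) (j + 1)) (pentagram v (i + 1) j) c)"

text \<open>Triples are chosen by index, so a quadrilateral with coinciding vertices is excluded.\<close>

definition no_three_collinear :: "(int \<Rightarrow> int \<Rightarrow> (real ^ 4) set) \<Rightarrow> bool" where
  "no_three_collinear v \<longleftrightarrow>
     (\<forall>i j. \<forall>T \<subseteq> {(0, 0), (0, 1), (1, 0), (1, 1)}. card T = 3 \<longrightarrow>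
        \<not> proj_collinear ((\<lambda>(a, b). v (i + a) (j + b)) ` T))"

text \<open>The variables of the second iterate involve the vertices of the third, hence \<open>k \<le> 2\<close> in
  the first quantifier; the last conjunct makes the reciprocals of the variables of the first iterate
  meaningful.\<close>

definition generic :: "(int \<Rightarrow> int \<Rightarrow> (real ^ 4) set) \<Rightarrow> bool" where
  "generic v \<longleftrightarrow> no_three_collinear v \<and>
     (\<forall>k\<le>2. pentagram_defined ((pentagram ^^ k) v) \<and> y_defined ((pentagram ^^ k) v)) \<and>
     (\<forall>i j. y_var (pentagram v) i j \<noteq> 0)"

end

theory Submission
  imports Defs
begin

text \<open>
  Lift the vertices \<open>v\<^sub>i\<^sub>,\<^sub>j\<close> to vectors \<open>X\<^sub>i\<^sub>,\<^sub>j\<close> and their images to vectors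
  \<open>Y\<^sub>i\<^sub>,\<^sub>j = a\<^sub>i\<^sub>,\<^sub>j X\<^sub>i\<^sub>,\<^sub>j + b\<^sub>i\<^sub>,\<^sub>j X\<^sub>i\<^sub>,\<^sub>j\<^sub>+\<^sub>1 = c\<^sub>i\<^sub>,\<^sub>j X\<^sub>i\<^sub>+\<^sub>1\<^sub>,\<^sub>j + d\<^sub>i\<^sub>,\<^sub>j X\<^sub>i\<^sub>+\<^sub>1\<^sub>,\<^sub>j\<^sub>+\<^sub>1\<close>. Then
  \<open>y\<^sub>i\<^sub>,\<^sub>j = - d\<^sub>i\<^sub>,\<^sub>j a\<^sub>i\<^sub>+\<^sub>1\<^sub>,\<^sub>j / (c\<^sub>i\<^sub>,\<^sub>j b\<^sub>i\<^sub>+\<^sub>1\<^sub>,\<^sub>j)\<close>. The image of \<open>Y\<close> at \<open>(i, j)\<close> lies in the plane with basis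
  \<open>X\<^sub>i\<^sub>+\<^sub>1\<^sub>,\<^sub>j, X\<^sub>i\<^sub>+\<^sub>1\<^sub>,\<^sub>j\<^sub>+\<^sub>1, X\<^sub>i\<^sub>+\<^sub>1\<^sub>,\<^sub>j\<^sub>+\<^sub>2\<close>; comparing coordinates there expresses the ratios of the
  coefficients of the next iterate through those of the current one. Substituting these ratios
  into \<open>y\<close> for two consecutive steps makes all coefficients cancel. No denominator vanishes:
  if \<open>1 + y\<close> were zero at one vertex, it would be zero at the next one too, and the two lines whose
  intersection is the next iterate would coincide.
\<close>

section \<open>Lines of projective space as planes of the vector space\<close>

lemma line_through_represents:
  assumes "represents X p" "represents Z q"
  shows "line_through p q = span {X, Z}"
proof -
  have "span (span {X} \<union> span {Z}) = span {X, Z}"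
    unfolding span_eq using span_mono[of "{X}" "{X, Z}"] span_mono[of "{Z}" "{X, Z}"]
    by (auto intro!: span_base)
  then show ?thesis
    using assms by (simp add: represents_def line_through_def)
qed

lemma dim_span_represents:
  assumes "represents X p" "represents Z q" "p \<noteq> q"
  shows "dim (span {X, Z}) = 2"
proof -
  have nz: "Z \<noteq> 0" and "X \<noteq> Z"
    using assms by (auto simp: represents_def)
  moreover have "X \<notin> span {Z}"
  proof
    assume "X \<in> span {Z}"
    then obtain k where "X = k *\<^sub>R Z" by (auto simp: span_singleton)
    then have "1 *\<^sub>R X + (- k) *\<^sub>R Z = 0" by simp
    from represents_indep[OF assms this] show False by simp
  qed
  ultimately have "independent {X, Z}"
    by (simp add: independent_insert)
  then show ?thesis
    using \<open>X \<noteq> Z\<close> by (simp add: dim_eq_card_independent)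
qed

lemma line_through_eq_plane:
  assumes "represents X p" "represents Z q" "p \<noteq> q"
    and "subspace L" "dim L = 2" "X \<in> L" "Z \<in> L"
  shows "line_through p q = L"
proof -
  have "span {X, Z} \<subseteq> L"
    using assms by (intro span_minimal) auto
  then have "span {X, Z} = L"
    using dim_span_represents[OF assms(1-3)] assms by (intro subspace_dim_equal) auto
  then show ?thesis
    using line_through_represents assms by metis
qed

lemma RP3_dim: "p \<in> RP3 \<Longrightarrow> dim p = 1"
  by (auto simp: RP3_def represents_def dim_insert)

text \<open>If one line contained all four vertices, both sides that the map intersects would equal
  it, and the intersection would have dimension 2 instead of being a point.\<close>

lemma pentagram_defined_not_collinear:
  assumes "pentagram_defined u" "\<And>i j. represents (X i j) (u i j)"
    and "subspace L" "dim L = 2"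
    and "X i j \<in> L" "X i (j + 1) \<in> L" "X (i + 1) j \<in> L" "X (i + 1) (j + 1) \<in> L"
  shows False
proof -
  have ne: "u i j \<noteq> u i (j + 1)" for i j
    using assms(1) by (simp add: pentagram_defined_def)
  have "line_through (u i j) (u i (j + 1)) = L"
    "line_through (u (i + 1) j) (u (i + 1) (j + 1)) = L"
    by (rule line_through_eq_plane[OF assms(2) assms(2) ne assms(3,4)]; fact assms)+
  then have "pentagram u i j = L"
    by (simp add: pentagram_def)
  then have "dim L = 1"
    using assms(1) RP3_dim by (metis pentagram_defined_def)
  then show False
    using assms by simp
qed

section \<open>Homogeneous lifts of the map and the passage to the next iterate\<close>

definition pentagram_lift where
  "pentagram_lift u X Y a b c d \<longleftrightarrow>
     (\<forall>i j. represents (X i j) (u i j) \<and> represents (Y i j) (pentagram u i j) \<and>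
        Y i j = a i j *\<^sub>R X i j + b i j *\<^sub>R X i (j + 1) \<and>
        Y i j = c i j *\<^sub>R X (i + 1) j + d i j *\<^sub>R X (i + 1) (j + 1))"

lemma pentagram_lift_represents:
  assumes "pentagram_lift u X Y a b c d"
  shows "represents (X i j) (u i j)" "represents (Y i j) (pentagram u i j)"
  using assms unfolding pentagram_lift_def by blast+

lemma pentagram_lift_exists:
  assumes "pentagram_defined u" "\<And>i j. represents (X i j) (u i j)"
  obtains Y a b c d where "pentagram_lift u X Y a b c d"
proof -
  have "\<exists>Y a b c d. represents Y (pentagram u i j) \<and>
      Y = a *\<^sub>R X i j + b *\<^sub>R X i (j + 1) \<and>
      Y = c *\<^sub>R X (i + 1) j + d *\<^sub>R X (i + 1) (j + 1)" for i j
  proof -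
    obtain Y where Y: "represents Y (pentagram u i j)"
      using assms(1) by (auto simp: pentagram_defined_def RP3_def)
    then have "Y \<in> pentagram u i j"
      by (simp add: represents_def span_base)
    then have "Y \<in> span {X i j, X i (j + 1)}" "Y \<in> span {X (i + 1) j, X (i + 1) (j + 1)}"
      by (simp_all add: pentagram_def line_through_represents[OF assms(2) assms(2)])
    then show ?thesis
      using Y by (auto simp: span_breakdown_eq span_singleton algebra_simps) (metis add.commute diff_add_cancel)
  qed
  then show thesis
    using that unfolding pentagram_lift_def using assms(2) by metis
qed

text \<open>The representatives that witness the cross-ratio differ from the lifted vectors by
  nonzero scalars only, so \<open>l1 * m2 \<noteq> 0\<close> carries over to \<open>c\<close> and
  \<open>b\<close>.\<close>

lemma pentagram_lift_y_var:
  assumes "pentagram_lift u X Y a b c d" "y_defined u"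
  shows "c i j \<noteq> 0" "b (i + 1) j \<noteq> 0"
    "y_var u i j = - (d i j * a (i + 1) j / (c i j * b (i + 1) j))"
proof -
  let ?P = "u (i + 1) j" and ?Q = "pentagram u i j"
    and ?R = "u (i + 1) (j + 1)" and ?S = "pentagram u (i + 1) j"
  let ?X = "X (i + 1) j" and ?Z = "X (i + 1) (j + 1)"
  have rep: "represents ?X ?P" "represents (Y i j) ?Q" "represents ?Z ?R"
      "represents (Y (i + 1) j) ?S"
    and Y: "Y i j = c i j *\<^sub>R ?X + d i j *\<^sub>R ?Z"
      "Y (i + 1) j = a (i + 1) j *\<^sub>R ?X + b (i + 1) j *\<^sub>R ?Z"
    using assms(1) unfolding pentagram_lift_def by blast+
  from assms(2) obtain k where "has_cross_ratio ?P ?Q ?R ?S k"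
    by (auto simp: y_defined_def)
  then obtain X' Y' Z' W' l1 l2 m1 m2 where PR: "?P \<noteq> ?R"
    and rep': "represents X' ?P" "represents Y' ?Q" "represents Z' ?R" "represents W' ?S"
    and Y': "Y' = l1 *\<^sub>R X' + l2 *\<^sub>R Z'" "W' = m1 *\<^sub>R X' + m2 *\<^sub>R Z'" "l1 * m2 \<noteq> 0"
    unfolding has_cross_ratio_def by blast
  obtain p where p: "p \<noteq> 0" "X' = p *\<^sub>R ?X" using represents_scale rep(1) rep'(1) by metis
  obtain q where q: "q \<noteq> 0" "Y' = q *\<^sub>R Y i j" using represents_scale rep(2) rep'(2) by metis
  obtain r where r: "r \<noteq> 0" "Z' = r *\<^sub>R ?Z" using represents_scale rep(3) rep'(3) by metis
  obtain s where s: "s \<noteq> 0" "W' = s *\<^sub>R Y (i + 1) j"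
    using represents_scale rep(4) rep'(4) by metis
  have "(q * c i j - l1 * p) *\<^sub>R ?X + (q * d i j - l2 * r) *\<^sub>R ?Z = 0"
    using Y'(1) Y(1) p q r by (simp add: algebra_simps)
  then have "q * c i j = l1 * p"
    using represents_indep[OF rep(1) rep(3) PR] by fastforce
  then show c: "c i j \<noteq> 0" using p Y'(3) by auto
  have "(s * a (i + 1) j - m1 * p) *\<^sub>R ?X + (s * b (i + 1) j - m2 * r) *\<^sub>R ?Z = 0"
    using Y'(2) Y(2) p s r by (simp add: algebra_simps)
  then have "s * b (i + 1) j = m2 * r"
    using represents_indep[OF rep(1) rep(3) PR] by fastforce
  then show b: "b (i + 1) j \<noteq> 0" using r Y'(3) by auto
  have "has_cross_ratio ?P ?Q ?R ?S (d i j * a (i + 1) j / (c i j * b (i + 1) j))"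
    unfolding has_cross_ratio_def using PR rep Y b c by (metis mult_eq_0_iff)
  then show "y_var u i j = - (d i j * a (i + 1) j / (c i j * b (i + 1) j))"
    by (simp add: y_var_def cross_ratio_eq)
qed

lemma pentagram_lift_step:
  assumes lift: "pentagram_lift u X Y a b c d"
    and lift': "pentagram_lift (pentagram u) Y Z a' b' c' d'"
    and def: "pentagram_defined u" "pentagram_defined (pentagram u)"
  shows "a' i j * c i j = c' i j * a (i + 1) j"
    and "b' i j * d i (j + 1) = d' i j * b (i + 1) (j + 1)"
    and "a' i j * d i j + b' i j * c i (j + 1) =
      c' i j * b (i + 1) j + d' i j * a (i + 1) (j + 1)"
proof -
  let ?A = "X (i + 1) j" and ?B = "X (i + 1) (j + 1)" and ?C = "X (i + 1) (j + 2)"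
  have j: "j + 1 + 1 = j + 2" by simp
  note rep = pentagram_lift_represents[OF lift]
  have Y: "Y i j = c i j *\<^sub>R ?A + d i j *\<^sub>R ?B"
    "Y (i + 1) j = a (i + 1) j *\<^sub>R ?A + b (i + 1) j *\<^sub>R ?B"
    "Y i (j + 1) = c i (j + 1) *\<^sub>R ?B + d i (j + 1) *\<^sub>R ?C"
    "Y (i + 1) (j + 1) = a (i + 1) (j + 1) *\<^sub>R ?B + b (i + 1) (j + 1) *\<^sub>R ?C"
    using lift unfolding pentagram_lift_def by (metis j)+
  have AB: "u (i + 1) j \<noteq> u (i + 1) (j + 1)"
    using def(1) by (auto simp: pentagram_defined_def)
  \<comment> \<open>Independence comes from the next iterate: otherwise all four \<open>Y\<close> at
    the corners of the quadrilateral would lie on the line through \<open>?A\<close> and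
    \<open>?B\<close>.\<close>
  have notin: "?C \<notin> span {?A, ?B}"
  proof
    assume C: "?C \<in> span {?A, ?B}"
    let ?L = "span {?A, ?B}"
    have "?A \<in> ?L" "?B \<in> ?L" by (auto intro: span_base)
    then have "Y i j \<in> ?L" "Y (i + 1) j \<in> ?L" "Y i (j + 1) \<in> ?L" "Y (i + 1) (j + 1) \<in> ?L"
      using C unfolding Y by (auto intro!: span_add span_scale)
    with pentagram_defined_not_collinear[OF def(2) rep(2)]
      dim_span_represents[OF rep(1) rep(1) AB]
    show False by blast
  qed
  have indep: "x = 0 \<and> y = 0 \<and> z = 0" if "x *\<^sub>R ?A + y *\<^sub>R ?B + z *\<^sub>R ?C = 0" for x y z
  proof -
    have "z = 0"
    proof (rule ccontr)
      assume "z \<noteq> 0"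
      have "z *\<^sub>R ?C = (- x) *\<^sub>R ?A + (- y) *\<^sub>R ?B"
        using that by (simp add: algebra_simps eq_neg_iff_add_eq_0)
      also have "\<dots> \<in> span {?A, ?B}"
        by (intro span_add span_scale span_base) auto
      finally show False
        using notin \<open>z \<noteq> 0\<close> by (metis scaleR_scaleR left_inverse scaleR_one span_scale)
    qed
    with that show ?thesis
      using represents_indep[OF rep(1) rep(1) AB] by auto
  qed
  have "a' i j *\<^sub>R Y i j + b' i j *\<^sub>R Y i (j + 1) =
      c' i j *\<^sub>R Y (i + 1) j + d' i j *\<^sub>R Y (i + 1) (j + 1)"
    using lift' by (metis pentagram_lift_def)
  then have "(a' i j * c i j - c' i j * a (i + 1) j) *\<^sub>R ?A +
      (a' i j * d i j + b' i j * c i (j + 1) - (c' i j * b (i + 1) j + d' i j * a (i + 1) (j + 1))) *\<^sub>R ?B +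
      (b' i j * d i (j + 1) - d' i j * b (i + 1) (j + 1)) *\<^sub>R ?C = 0"
    unfolding Y by (simp add: algebra_simps)
  from indep[OF this] show "a' i j * c i j = c' i j * a (i + 1) j"
    "b' i j * d i (j + 1) = d' i j * b (i + 1) (j + 1)"
    "a' i j * d i j + b' i j * c i (j + 1) = c' i j * b (i + 1) j + d' i j * a (i + 1) (j + 1)"
    by auto
qed

text \<open>This is the \<open>?B\<close>-coordinate relation of \<open>pentagram_lift_step\<close>.
  The other two relations turn its terms \<open>a' i j * d i j\<close> and
  \<open>d' i j * a (i + 1) (j + 1)\<close> into multiples of \<open>y_var\<close>, and what remains
  factors on each side.\<close>

lemma pentagram_lift_y_step:
  assumes lift: "pentagram_lift u X Y a b c d"
    and lift': "pentagram_lift (pentagram u) Y Z a' b' c' d'"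
    and def: "pentagram_defined u" "pentagram_defined (pentagram u)"
    and y: "y_defined u"
  shows "b' i j * c i (j + 1) * (1 + y_var u i (j + 1)) = c' i j * b (i + 1) j * (1 + y_var u i j)"
proof -
  note nz = pentagram_lift_y_var[OF lift y]
  note step = pentagram_lift_step[OF lift lift' def, of i j]
  have "c' i j * b (i + 1) j * y_var u i j = - (c' i j * a (i + 1) j) * d i j / c i j"
    using nz(1,2)[of i j] by (simp add: nz(3) field_simps)
  also have "\<dots> = - (a' i j * d i j)"
    using nz[of i j] by (simp flip: step(1))
  finally have 1: "c' i j * b (i + 1) j * y_var u i j = - (a' i j * d i j)" .
  have "b' i j * c i (j + 1) * y_var u i (j + 1) =
      - (b' i j * d i (j + 1)) * a (i + 1) (j + 1) / b (i + 1) (j + 1)"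
    using nz(1,2)[of i "j + 1"] by (simp add: nz(3) field_simps)
  also have "\<dots> = - (d' i j * a (i + 1) (j + 1))"
    using nz[of i "j + 1"] by (simp add: step(2))
  finally show ?thesis
    using 1 step(3) by (simp add: algebra_simps)
qed

lemma scaleR_pair_mem_span:
  fixes A B :: "real ^ 4"
  assumes "d * a = c * b" "c \<noteq> 0"
  shows "a *\<^sub>R A + b *\<^sub>R B \<in> span {c *\<^sub>R A + d *\<^sub>R B}"
proof -
  have "b = (a / c) * d"
    using assms by (simp add: field_simps)
  then have "a *\<^sub>R A + b *\<^sub>R B = (a / c) *\<^sub>R (c *\<^sub>R A + d *\<^sub>R B)"
    using assms(2) by (simp add: algebra_simps)
  then show ?thesis
    by (metis insertI1 span_base span_scale)
qed

lemma y_var_neq_minus_one: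
  assumes lift: "pentagram_lift u X Y a b c d"
    and lift': "pentagram_lift (pentagram u) Y Z a' b' c' d'"
    and def: "pentagram_defined u" "pentagram_defined (pentagram u)"
    and y: "y_defined u" "y_defined (pentagram u)"
  shows "1 + y_var u i j \<noteq> 0"
proof
  note nz = pentagram_lift_y_var[OF lift y(1)]
  assume y0: "1 + y_var u i j = 0"
  have "b' i j \<noteq> 0"
    using pentagram_lift_y_var(2)[OF lift' y(2), of "i - 1" j] by simp
  then have y1: "1 + y_var u i (j + 1) = 0"
    using pentagram_lift_y_step[OF lift lift' def y(1), of i j] y0 nz(1)[of i "j + 1"] by auto
  note rep = pentagram_lift_represents(2)[OF lift]
  \<comment> \<open>The equation 1 + y = 0 says that a 2 by 2 determinant vanishes: the coordinates
    of \<open>Y i k\<close> and \<open>Y (i + 1) k\<close> on their common line are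
    proportional.\<close>
  have mem: "Y (i + 1) k \<in> span {Y i k}" if "1 + y_var u i k = 0" for k
  proof -
    have "d i k * a (i + 1) k = c i k * b (i + 1) k"
      using that nz(1,2)[of i k] by (simp add: nz(3) field_simps)
    then show ?thesis
      using scaleR_pair_mem_span nz(1)[of i k] lift unfolding pentagram_lift_def by metis
  qed
  let ?L = "span {Y i j, Y i (j + 1)}"
  have "Y (i + 1) j \<in> ?L" "Y (i + 1) (j + 1) \<in> ?L"
    using mem[OF y0] mem[OF y1] span_mono[of "{Y i j}" "{Y i j, Y i (j + 1)}"]
      span_mono[of "{Y i (j + 1)}" "{Y i j, Y i (j + 1)}"] by auto
  moreover have "Y i j \<in> ?L" "Y i (j + 1) \<in> ?L"
    by (auto intro: span_base)
  moreover have "dim ?L = 2"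
    using def(2) by (intro dim_span_represents[OF rep rep]) (auto simp: pentagram_defined_def)
  ultimately show False
    using pentagram_defined_not_collinear[OF def(2) rep] subspace_span by blast
qed

theorem mainTheorem4:
  fixes v :: "int \<Rightarrow> int \<Rightarrow> (real ^ 4) set" and N M :: nat
  assumes "twisted_hedron N M v"
    and "corrugated {(0, 0), (0, 1), (1, 0), (1, 1)} v"
    and "generic v"
  shows "\<forall>i j. y_var v (i + 2) (j + 1) * y_var (pentagram (pentagram v)) (i + 1) j =
    ((1 + y_var (pentagram v) (i + 1) j) * (1 + y_var (pentagram v) (i + 2) (j + 1))) /
    ((1 + inverse (y_var (pentagram v) (i + 2) j)) * (1 + inverse (y_var (pentagram v) (i + 1) (j + 1))))"
proof (intro allI)
  fix i j
  let ?v1 = "pentagram v" and ?v2 = "pentagram (pentagram v)"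
  have gen: "pentagram_defined ((pentagram ^^ k) v)" "y_defined ((pentagram ^^ k) v)"
    if "k \<le> 2" for k
    using assms(3) that by (auto simp: generic_def)
  have def: "pentagram_defined v" "pentagram_defined ?v1" "pentagram_defined ?v2"
    and yd: "y_defined v" "y_defined ?v1" "y_defined ?v2"
    using gen[of 0] gen[of 1] gen[of 2] by (simp_all add: numeral_2_eq_2)
  have "\<forall>i j. \<exists>X. represents X (v i j)"
    using assms(1) by (auto simp: twisted_hedron_def RP3_def)
  then obtain X0 where X0: "\<And>i j. represents (X0 i j) (v i j)"
    by metis
  obtain X1 a b c d where l0: "pentagram_lift v X0 X1 a b c d"
    using pentagram_lift_exists[OF def(1) X0] by blast
  \<comment> \<open>The vectors \<open>X1\<close> produced by one lift are the vertices of the next,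
    so that the coefficients of consecutive steps are comparable.\<close>
  obtain X2 a' b' c' d' where l1: "pentagram_lift ?v1 X1 X2 a' b' c' d'"
    using pentagram_lift_exists[OF def(2) pentagram_lift_represents(2)[OF l0]] by blast
  obtain X3 a'' b'' c'' d'' where l2: "pentagram_lift ?v2 X2 X3 a'' b'' c'' d''"
    using pentagram_lift_exists[OF def(3) pentagram_lift_represents(2)[OF l1]] by blast
  have nz0: "c i j \<noteq> 0" "b i j \<noteq> 0" for i j
    using pentagram_lift_y_var(1)[OF l0 yd(1)] pentagram_lift_y_var(2)[OF l0 yd(1), of "i - 1" j]
    by auto
  have nz1: "c' i j \<noteq> 0" "b' i j \<noteq> 0" for i j
    using pentagram_lift_y_var(1)[OF l1 yd(2)] pentagram_lift_y_var(2)[OF l1 yd(2), of "i - 1" j]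
    by auto
  have nz2: "c'' i j \<noteq> 0" "b'' i j \<noteq> 0" for i j
    using pentagram_lift_y_var(1)[OF l2 yd(3)] pentagram_lift_y_var(2)[OF l2 yd(3), of "i - 1" j]
    by auto
  note yvar0 = pentagram_lift_y_var(3)[OF l0 yd(1)]
  note yvar1 = pentagram_lift_y_var(3)[OF l1 yd(2)]
  note yvar2 = pentagram_lift_y_var(3)[OF l2 yd(3)]
  have y1: "y_var ?v1 i j \<noteq> 0" for i j
    using assms(3) by (auto simp: generic_def)
  have y1': "1 + y_var ?v1 i j \<noteq> 0" for i j
    by (rule y_var_neq_minus_one[OF l1 l2 def(2,3) yd(2,3)])
  define p q r s where pqrs: "p = y_var ?v1 (i + 1) j" "q = y_var ?v1 (i + 2) (j + 1)"
    "r = y_var ?v1 (i + 2) j" "s = y_var ?v1 (i + 1) (j + 1)"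
  have i: "i + 1 + 1 = i + 2" "i + 2 + 1 = i + 3" "j + 1 + 1 = j + 2" by auto
  have ry: "r = - (d' (i + 2) j * a' (i + 3) j / (c' (i + 2) j * b' (i + 3) j))"
    using yvar1[of "i + 2" j] by (simp add: pqrs i)
  have sy: "s = - (d' (i + 1) (j + 1) * a' (i + 2) (j + 1) / (c' (i + 1) (j + 1) * b' (i + 2) (j + 1)))"
    using yvar1[of "i + 1" "j + 1"] by (simp add: pqrs i)
  \<comment> \<open>The variable of \<open>v\<close> is grouped into the ratios d/b and a/c, since
    the step relations determine exactly these by coefficients of the first iterate.\<close>
  have "d (i + 2) (j + 1) / b (i + 3) (j + 1) = d' (i + 2) j / b' (i + 2) j"
    using pentagram_lift_step(2)[OF l0 l1 def(1,2), of "i + 2" j] nz0 nz1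
    by (simp add: i field_simps)
  moreover have "a (i + 3) (j + 1) / c (i + 2) (j + 1) = a' (i + 2) (j + 1) / c' (i + 2) (j + 1)"
    using pentagram_lift_step(1)[OF l0 l1 def(1,2), of "i + 2" "j + 1"] nz0 nz1
    by (simp add: i field_simps)
  moreover have "y_var v (i + 2) (j + 1) =
      - ((d (i + 2) (j + 1) / b (i + 3) (j + 1)) * (a (i + 3) (j + 1) / c (i + 2) (j + 1)))"
    using yvar0[of "i + 2" "j + 1"] by (simp add: i)
  ultimately have Y0: "y_var v (i + 2) (j + 1) =
      - (d' (i + 2) j * a' (i + 2) (j + 1) / (b' (i + 2) j * c' (i + 2) (j + 1)))"
    by simp
  \<comment> \<open>The coefficients \<open>d''\<close> and \<open>a''\<close> are reduced to
    \<open>b'' (i + 1) j\<close> and \<open>c'' (i + 2) j\<close>, and these to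
    \<open>c'' (i + 1) j\<close> and \<open>b'' (i + 2) j\<close>, which cancel against the
    denominator of the variable.\<close>
  have "d'' (i + 1) j = b'' (i + 1) j * d' (i + 1) (j + 1) / b' (i + 2) (j + 1)"
    using pentagram_lift_step(2)[OF l1 l2 def(2,3), of "i + 1" j] nz1
    by (simp add: i field_simps)
  moreover have "a'' (i + 2) j = c'' (i + 2) j * a' (i + 3) j / c' (i + 2) j"
    using pentagram_lift_step(1)[OF l1 l2 def(2,3), of "i + 2" j] nz1
    by (simp add: i field_simps)
  moreover have "b'' (i + 1) j = c'' (i + 1) j * b' (i + 2) j * (1 + p) / (c' (i + 1) (j + 1) * (1 + s))"
    using pentagram_lift_y_step[OF l1 l2 def(2,3) yd(2), of "i + 1" j] nz1 y1'[of "i + 1" "j + 1"]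
    unfolding pqrs by (simp add: i nonzero_eq_divide_eq mult.assoc)
  moreover have "c'' (i + 2) j = b'' (i + 2) j * c' (i + 2) (j + 1) * (1 + q) / (b' (i + 3) j * (1 + r))"
    using pentagram_lift_y_step[OF l1 l2 def(2,3) yd(2), of "i + 2" j] nz1 y1'[of "i + 2" j]
    unfolding pqrs by (simp add: i nonzero_eq_divide_eq mult.assoc)
  moreover have "y_var ?v2 (i + 1) j = - (d'' (i + 1) j * a'' (i + 2) j / (c'' (i + 1) j * b'' (i + 2) j))"
    using yvar2[of "i + 1" j] by (simp add: i)
  ultimately have Y2: "y_var ?v2 (i + 1) j =
      - ((b' (i + 2) j * (1 + p) / (c' (i + 1) (j + 1) * (1 + s))) * (d' (i + 1) (j + 1) / b' (i + 2) (j + 1))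
        * (c' (i + 2) (j + 1) * (1 + q) / (b' (i + 3) j * (1 + r))) * (a' (i + 3) j / c' (i + 2) j))"
    using nz2 by simp
  have "y_var v (i + 2) (j + 1) * y_var ?v2 (i + 1) j = r * s * ((1 + p) * (1 + q)) / ((1 + r) * (1 + s))"
  proof -
    \<comment> \<open>The factors \<open>b' (i + 2) j\<close> and \<open>c' (i + 2) (j + 1)\<close>
      cancel between \<open>Y0\<close> and \<open>Y2\<close>; the coefficients left over are those
      of r * s.\<close>
    have rs: "r * s = d' (i + 2) j * a' (i + 3) j / (c' (i + 2) j * b' (i + 3) j) *
        (d' (i + 1) (j + 1) * a' (i + 2) (j + 1) / (c' (i + 1) (j + 1) * b' (i + 2) (j + 1)))"
      by (simp add: ry sy)
    show ?thesis
      unfolding Y0 Y2 rs using nz1 by (simp add: ac_simps)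
  qed
  also have "\<dots> = ((1 + p) * (1 + q)) / ((1 + inverse r) * (1 + inverse s))"
  proof -
    have nz: "r \<noteq> 0" "s \<noteq> 0" using y1 by (auto simp: pqrs)
    then have "1 + inverse r = (1 + r) / r" "1 + inverse s = (1 + s) / s"
      by (simp_all add: field_simps)
    then show ?thesis
      using nz by simp
  qed
  finally show "y_var v (i + 2) (j + 1) * y_var ?v2 (i + 1) j =
    ((1 + y_var ?v1 (i + 1) j) * (1 + y_var ?v1 (i + 2) (j + 1))) /
    ((1 + inverse (y_var ?v1 (i + 2) j)) * (1 + inverse (y_var ?v1 (i + 1) (j + 1))))"
    by (simp add: pqrs)
qed

end
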